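(* Let $f\colon[0,1)\to\mathbb{R}$ be a function and let $\epsilon\in(0,1)$, $a,b,r\in\mathbb{R}^+$ be constants such that $f$ is monotone increasing on $[0,\epsilon]$ and $a x^r\le f(x)\le b x^r$ for every $x\in[0,\epsilon]$. Let $m\ge 1$ and let $k_1\ge k_2\ge\dots\ge k_m>0$ be real numbers. Put $$d_{IM}=\sqrt[r]{\frac{b}{b+a}}.$$ If $d_{IM}\le\epsilon$, then for every $x\in[d_{IM},\epsilon]$ the achievement set $E\bigl(w_n(x)\bigr)$ is a compact interval.
   Context: The achievement set of a summable sequence $(z_n)_{n\ge1}$ of non-negative reals is $E(z_n)=\{\sum_{n=1}^\infty c_n z_n : c_n\in\{0,1\}\}$. Given $f$ and $k_1,\dots,k_m$ as in the claim, the generalized multigeometric sequence is $w_n(x)=k_{g(n)}\,f\bigl(x^{\lfloor (m+n-1)/m\rfloor}\bigr)$ for $n\ge1$, where $g(n)=1+((n-1)\bmod m)$; that is, the sequence $k_1f(x),\dots,k_mf(x),k_1f(x^2),\dots,k_mf(x^2),\dots$. "Monotone increasing" on $[0,\epsilon]$ means $f(x)\le f(y)$ whenever $0\le x\le y\le\epsilon$. $\sqrt[r]{t}$ denotes $t^{1/r}$, with $r$ a positive real. *)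

theory Defs
  imports Complex_Main
begin

text \<open>Sequences are indexed from 1 on; the value at index 0 is ignored. Using \<open>sums\<close> instead of
  \<open>suminf\<close> means that only convergent subseries contribute; for a summable sequence
  of non-negative reals every subseries converges.\<close>

definition achievement_set :: "(nat \<Rightarrow> real) \<Rightarrow> real set" where
  "achievement_set z =
     {s. \<exists>c :: nat \<Rightarrow> real. (\<forall>n\<ge>1. c n \<in> {0, 1}) \<and> (\<lambda>n. c (Suc n) * z (Suc n)) sums s}"

text \<open>The sequence \<open>k 1 * f x, \<dots>, k m * f x, k 1 * f (x\<^sup>2), \<dots>, k m * f (x\<^sup>2), \<dots>\<close>,
  starting at index \<open>n = 1\<close>; \<open>div\<close> on naturals is the floor of the quotient.\<close>

definition gen_multigeometric ::
  "(real \<Rightarrow> real) \<Rightarrow> nat \<Rightarrow> (nat \<Rightarrow> real) \<Rightarrow> real \<Rightarrow> nat \<Rightarrow> real" where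
  "gen_multigeometric f m k x n = k (1 + (n - 1) mod m) * f (x ^ ((m + n - 1) div m))"

end

theory Submission
  imports Defs
begin

text \<open>A series of non-negative terms in which no term exceeds the sum of the terms after it attains
  every value between \<open>0\<close> and its total as a subsum. A greedy choice shows this: a term is
  taken exactly when the remaining target exceeds what the later terms can supply, and the
  inequality guarantees that taking it does not overshoot
  (\<open>achievement_set_eq_interval\<close>). The argument works for terms in any order, so the
  blocks \<open>k 1 * f (x ^ p), \<dots>, k m * f (x ^ p)\<close> may overlap in size.

  For the multigeometric sequence, it is enough to compare a term \<open>k i * f (x ^ p)\<close> with the later
  terms carrying the same factor \<open>k i\<close>. With \<open>y = x powr r\<close>, the bounds on \<open>f\<close> reduce the comparison
  to \<open>b * y ^ p \<le> a * y ^ (p + 1) / (1 - y)\<close>, which is \<open>y \<ge> b / (b + a)\<close>, that is,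
  \<open>x\<close> is at least the constant \<open>d\<^sub>I\<^sub>M\<close>.\<close>

text \<open>The sufficiency half of Kakeya's criterion. The greedy remainder \<open>R n\<close> always lies between
  \<open>0\<close> and the \<open>n\<close>-th tail of the series, so it tends to \<open>0\<close>.\<close>

lemma achievement_set_eq_interval:
  fixes z :: "nat \<Rightarrow> real"
  assumes nonneg: "\<And>n. 0 \<le> z (Suc n)"
    and summable: "summable (\<lambda>n. z (Suc n))"
    and le_tail: "\<And>n. z (Suc n) \<le> (\<Sum>i. z (Suc (i + Suc n)))"
  shows "achievement_set z = {0..(\<Sum>n. z (Suc n))}"
proof (intro equalityI subsetI)
  fix s assume "s \<in> achievement_set z"
  then obtain c :: "nat \<Rightarrow> real" where c: "\<forall>n\<ge>1. c n \<in> {0, 1}"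
    and sums: "(\<lambda>n. c (Suc n) * z (Suc n)) sums s"
    by (auto simp: achievement_set_def)
  have c01: "c (Suc n) = 0 \<or> c (Suc n) = 1" for n
    using c by auto
  have "0 \<le> c (Suc n) * z (Suc n)" "c (Suc n) * z (Suc n) \<le> z (Suc n)" for n
    using c01[of n] nonneg[of n] by auto
  then have "0 \<le> s" "s \<le> (\<Sum>n. z (Suc n))"
    using sums_le[OF _ sums_zero sums] sums_le[OF _ sums summable_sums[OF summable]] by auto
  then show "s \<in> {0..(\<Sum>n. z (Suc n))}"
    by simp
next
  fix s assume s: "s \<in> {0..(\<Sum>n. z (Suc n))}"
  define T where "T n = (\<Sum>i. z (Suc i)) - (\<Sum>i<n. z (Suc i))" for n
  have T_Suc: "T n = z (Suc n) + T (Suc n)" for n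
    by (simp add: T_def)
  have z_le_T: "z (Suc n) \<le> T (Suc n)" for n
    using le_tail[of n] suminf_minus_initial_segment[OF summable, of "Suc n"]
    by (simp add: T_def)
  have T_lim: "T \<longlonglongrightarrow> 0"
    using tendsto_diff[OF tendsto_const[of "\<Sum>i. z (Suc i)"] summable_LIMSEQ[OF summable]]
    by (simp add: T_def[abs_def])
  define R where "R = rec_nat s (\<lambda>n t. if t \<le> T (Suc n) then t else t - z (Suc n))"
  have R_0: "R 0 = s"
    and R_Suc: "R (Suc n) = (if R n \<le> T (Suc n) then R n else R n - z (Suc n))" for n
    by (simp_all add: R_def)
  have R_bounds: "0 \<le> R n \<and> R n \<le> T n" for n
  proof (induction n)
    case 0
    then show ?case using s by (simp add: R_0 T_def)
  next
    case (Suc n)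
    then show ?case using T_Suc[of n] z_le_T[of n] by (auto simp: R_Suc)
  qed
  have R_lim: "R \<longlonglongrightarrow> 0"
    by (rule tendsto_sandwich[OF _ _ tendsto_const T_lim]) (use R_bounds in auto)
  define c :: "nat \<Rightarrow> real" where "c n = (if R (n - 1) \<le> T n then 0 else 1)" for n
  have partial: "(\<Sum>i<n. c (Suc i) * z (Suc i)) = s - R n" for n
    by (induction n) (auto simp: R_0 R_Suc c_def)
  have "(\<lambda>n. c (Suc n) * z (Suc n)) sums s"
    unfolding sums_def partial using tendsto_diff[OF tendsto_const R_lim, of s] by simp
  moreover have "\<forall>n\<ge>1. c n \<in> {0, 1}"
    by (simp add: c_def)
  ultimately show "s \<in> achievement_set z"
    by (auto simp: achievement_set_def)
qed

lemma gen_multigeometric_Suc: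
  assumes "m \<ge> 1"
  shows "gen_multigeometric f m k x (Suc n) = k (Suc (n mod m)) * f (x ^ Suc (n div m))"
  using assms by (simp add: gen_multigeometric_def)

text \<open>Repeating each term of a geometric series \<open>m\<close> times still gives a convergent series, since the
  result is dominated by a geometric series whose ratio is the \<open>m\<close>-th root of the original one.\<close>

lemma summable_power_div:
  fixes y :: real
  assumes "0 < y" "y < 1" "m \<ge> 1"
  shows "summable (\<lambda>n. y ^ (n div m))"
proof (rule summable_comparison_test')
  define t where "t = y powr (1 / real m)"
  have "0 < t" "t < 1"
    using assms powr_less_mono2[of "1 / real m" y 1] by (auto simp: t_def)
  then show "summable (\<lambda>n. inverse y * t ^ n)"
    by (intro summable_mult summable_geometric) simp
  fix n :: nat
  have "n < m * (n div m) + m"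
    using assms(3) mod_less_divisor[of m n] mult_div_mod_eq[of m n] by linarith
  then have "real n < real m * real (n div m) + real m"
    by (metis of_nat_add of_nat_less_iff of_nat_mult)
  then have "real n / real m - 1 \<le> real (n div m)"
    using assms(3) by (simp add: field_simps)
  then have "y powr real (n div m) \<le> y powr (real n / real m - 1)"
    using assms by (intro powr_mono') auto
  also have "\<dots> = inverse y * t ^ n"
    using assms by (simp add: t_def powr_diff powr_powr flip: powr_realpow) (simp add: divide_simps)
  finally show "norm (y ^ (n div m)) \<le> inverse y * t ^ n"
    using assms by (simp add: powr_realpow)
qed

text \<open>The comparison takes place within one residue class modulo \<open>m\<close>, where the factor \<open>k i\<close>
  is constant and the arguments of \<open>f\<close> are consecutive powers of \<open>x\<close>.\<close>

lemma gen_multigeometric_achievement_set: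
  fixes f :: "real \<Rightarrow> real" and k :: "nat \<Rightarrow> real"
  assumes m: "m \<ge> 1"
    and k_nonneg: "\<And>i. i < m \<Longrightarrow> 0 \<le> k (Suc i)"
    and y: "0 < y" "y < 1"
    and a: "0 \<le> a"
    and lower: "\<And>p. a * y ^ Suc p \<le> f (x ^ Suc p)"
    and upper: "\<And>p. f (x ^ Suc p) \<le> b * y ^ Suc p"
    and ratio: "b * (1 - y) \<le> a * y"
  defines "w \<equiv> gen_multigeometric f m k x"
  shows "achievement_set w = {0..(\<Sum>n. w (Suc n))}"
proof (rule achievement_set_eq_interval)
  have w: "w (Suc n) = k (Suc (n mod m)) * f (x ^ Suc (n div m))" for n
    unfolding w_def using m by (rule gen_multigeometric_Suc)
  have kn: "0 \<le> k (Suc (n mod m))" for n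
    using m by (intro k_nonneg) simp
  have f_nonneg: "0 \<le> f (x ^ Suc p)" for p
    using lower[of p] a y by (smt (verit) mult_nonneg_nonneg zero_le_power)
  show w_nonneg: "0 \<le> w (Suc n)" for n
    unfolding w using kn f_nonneg by (rule mult_nonneg_nonneg)
  show w_summable: "summable (\<lambda>n. w (Suc n))"
  proof (rule summable_comparison_test')
    define K where "K = (\<Sum>i<m. k (Suc i))"
    have kK: "k (Suc (n mod m)) \<le> K" for n
      unfolding K_def using m k_nonneg by (intro member_le_sum) auto
    show "summable (\<lambda>n. K * b * y * y ^ (n div m))"
      using summable_power_div[OF y m] by (rule summable_mult)
    fix n
    have "w (Suc n) \<le> K * (b * y ^ Suc (n div m))"
      unfolding w using kK kn f_nonneg upper by (meson mult_mono order_trans)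
    then show "norm (w (Suc n)) \<le> K * b * y * y ^ (n div m)"
      using w_nonneg[of n] by (simp add: mult_ac)
  qed
  fix n
  define g where "g j = m * Suc j - Suc 0" for j
  \<comment> \<open>The tail past index \<open>n\<close> starts at offset \<open>0\<close> with index \<open>Suc n\<close>, so the later members of
      the residue class of \<open>n\<close> sit at the offsets \<open>m * (j + 1) - 1\<close>.\<close>
  have g: "g j + Suc n = n + m * Suc j" for j
    using m by (simp add: g_def)
  have "inj g"
    using g m by (intro injI) (metis add_left_cancel mult_cancel1 nat.inject not_one_le_zero)
  let ?tail = "\<lambda>i. w (Suc (i + Suc n))"
  have tail_summable: "summable ?tail"
    using w_summable summable_iff_shift[of "\<lambda>n. w (Suc n)" "Suc n"] by simp
  define q where "q = n div m"
  define \<kappa> where "\<kappa> = k (Suc (n mod m))"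
  have tail_g: "(?tail \<circ> g) j = \<kappa> * f (x ^ Suc (q + Suc j))" for j
    unfolding comp_def g w using m by (simp add: q_def \<kappa>_def add.commute del: mult_Suc_right)
  have geometric: "(\<lambda>j. \<kappa> * (a * y ^ Suc (q + Suc j))) sums (\<kappa> * (a * (y ^ Suc (Suc q) / (1 - y))))"
  proof -
    have "(\<lambda>j. (\<kappa> * (a * y ^ Suc (Suc q))) * y ^ j) sums
        ((\<kappa> * (a * y ^ Suc (Suc q))) * (1 / (1 - y)))"
      using y by (intro sums_mult geometric_sums) simp
    then show ?thesis
      by (simp add: power_add mult_ac)
  qed
  have \<kappa>: "0 \<le> \<kappa>"
    unfolding \<kappa>_def by (rule kn)
  have "b \<le> a * y / (1 - y)"
    using ratio y by (simp add: pos_le_divide_eq)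
  then have "b * y ^ Suc q \<le> a * y / (1 - y) * y ^ Suc q"
    using y by (intro mult_right_mono) auto
  then have "f (x ^ Suc q) \<le> a * (y ^ Suc (Suc q) / (1 - y))"
    using upper[of q] by (simp add: mult_ac)
  then have "w (Suc n) \<le> \<kappa> * (a * (y ^ Suc (Suc q) / (1 - y)))"
    unfolding w q_def[symmetric] \<kappa>_def[symmetric] using \<kappa> by (rule mult_left_mono)
  also have "\<dots> \<le> suminf (?tail \<circ> g)"
  proof (rule sums_le[OF _ geometric])
    show "(?tail \<circ> g) sums suminf (?tail \<circ> g)"
      using summable_reindex[OF tail_summable \<open>inj g\<close>] w_nonneg by (simp add: summable_sums)
    show "\<kappa> * (a * y ^ Suc (q + Suc j)) \<le> (?tail \<circ> g) j" for j
      unfolding tail_g using \<kappa> lower by (rule mult_left_mono[rotated])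
  qed
  also have "\<dots> \<le> suminf ?tail"
    using suminf_reindex_mono[OF tail_summable \<open>inj g\<close>] w_nonneg by simp
  finally show "w (Suc n) \<le> suminf ?tail" .
qed

theorem corollary2p9:
  fixes f :: "real \<Rightarrow> real" and \<epsilon> a b r d\<^sub>I\<^sub>M :: real and m :: nat and k :: "nat \<Rightarrow> real"
  assumes eps: "\<epsilon> \<in> {0<..<1}"
    and pos: "a > 0" "b > 0" "r > 0"
    and mono: "mono_on {0..\<epsilon>} f"
    and bounds: "\<And>x. x \<in> {0..\<epsilon>} \<Longrightarrow> a * x powr r \<le> f x \<and> f x \<le> b * x powr r"
    and m: "m \<ge> 1"
    and k_decreasing: "\<And>i. 1 \<le> i \<Longrightarrow> i < m \<Longrightarrow> k (Suc i) \<le> k i"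
    and k_pos: "k m > 0"
    and d_def: "d\<^sub>I\<^sub>M = (b / (b + a)) powr (1 / r)"
    and d_le: "d\<^sub>I\<^sub>M \<le> \<epsilon>"
  shows "\<forall>x \<in> {d\<^sub>I\<^sub>M..\<epsilon>}. \<exists>u v. u \<le> v \<and>
           achievement_set (gen_multigeometric f m k x) = {u..v}"
proof
  fix x assume x: "x \<in> {d\<^sub>I\<^sub>M..\<epsilon>}"
  have x0: "0 < x"
    using x pos d_def by (smt (verit) atLeastAtMost_iff divide_pos_pos powr_gt_zero)
  have x1: "x < 1"
    using x eps by auto
  define y where "y = x powr r"
  have y: "0 < y" "y < 1"
    using x0 x1 pos powr_less_mono2[of r x 1] by (auto simp: y_def)
  have power_powr: "(x ^ p) powr r = y ^ p" for p
    using x0 y by (simp add: y_def powr_powr mult_ac flip: powr_realpow)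
  have power_mem: "x ^ Suc p \<in> {0..\<epsilon>}" for p
  proof -
    have "x ^ Suc p \<le> x"
      using x0 x1 power_decreasing[of 1 "Suc p" x] by (simp del: power_Suc)
    then show ?thesis
      using x x0 by (auto simp del: power_Suc)
  qed
  have "b / (b + a) = d\<^sub>I\<^sub>M powr r"
    using pos by (simp add: d_def powr_powr)
  also have "\<dots> \<le> y"
    unfolding y_def using x pos by (intro powr_mono2) (auto simp: d_def)
  finally have ratio: "b * (1 - y) \<le> a * y"
    using pos by (simp add: field_simps)
  have k_nonneg: "0 \<le> k (Suc i)" if "i < m" for i
  proof -
    have "Suc i \<le> m"
      using that by simp
    then have "k m \<le> k (Suc i)"
    proof (induction rule: inc_induct)
      case (step j)
      then show ?case using k_decreasing[of j] by force
    qed simp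
    then show ?thesis
      using k_pos by simp
  qed
  let ?w = "gen_multigeometric f m k x"
  have E: "achievement_set ?w = {0..(\<Sum>n. ?w (Suc n))}"
    using m k_nonneg y less_imp_le[OF pos(1)]
  proof (rule gen_multigeometric_achievement_set)
    show "a * y ^ Suc p \<le> f (x ^ Suc p)" "f (x ^ Suc p) \<le> b * y ^ Suc p" for p
      using bounds[OF power_mem[of p]] unfolding power_powr by auto
  qed (use ratio in auto)
  \<comment> \<open>The empty subsum shows that the interval is non-empty.\<close>
  have "0 \<in> achievement_set ?w"
    unfolding achievement_set_def by (intro CollectI exI[of _ "\<lambda>_. 0"]) simp
  then show "\<exists>u v. u \<le> v \<and> achievement_set ?w = {u..v}"
    using E by (intro exI[of _ 0] exI[of _ "\<Sum>n. ?w (Suc n)"]) auto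
qed

end
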